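(* Let $p$ be an odd prime. Let $H$ be a finite special Miller $p$-group such that $H^p<H'$ (proper containment) and the map $H/H'\rightarrow H^p$, $hH'\mapsto h^p$, is injective. Let $M$ be a subgroup of order $p$ in $H'$ with $M\nsubseteq H^p$. Let $G_1=H\rtimes_M\langle z\rangle$, where $z$ acts trivially on $H$ and $z$ has order $p^2$. If $H/M$ is a special Miller $p$-group, then $G_1$ is a (non-special) Miller group.
   Context: Notation: $H'$ is the commutator subgroup of $H$; $H^p=\langle h^p : h\in H\rangle$; $\Phi(H)$ is the Frattini subgroup and $Z(H)$ the center. A Miller group is a non-abelian group whose automorphism group is abelian. A $p$-group $K$ is special if $Z(K)=K'=\Phi(K)$. (For $H$ special and $p$ odd, the map $hH'\mapsto h^p$ is well defined.) Amalgamated semi-direct product: a group $G$ is the amalgamated semi-direct product of subgroups $H$ by $K$ over $M$, written $G=H\rtimes_M K$, if $H\trianglelefteq G$, $G=HK$ and $H\cap K=M$. (Externally: $M\leq H$ is identified with a subgroup of $K$ by an injective homomorphism, compatibly with a given action of $K$ on $H$.) Here $K=\langle z\rangle$ is cyclic of order $p^2$, $z$ commutes with every element of $H$ inside $G_1$, and $H\cap\langle z\rangle=M=\langle z^p\rangle$. *)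

theory Defs
  imports "HOL-Algebra.Algebra" "HOL-Algebra.Bij"
begin

text \<open>All notions below are attached to a group structure. A subgroup \<open>H\<close> of \<open>G\<close>, regarded as a
  group in its own right, is \<open>G\<lparr>carrier := H\<rparr>\<close>.\<close>

definition center :: "('a, 'b) monoid_scheme \<Rightarrow> 'a set" where
  "center G = {x \<in> carrier G. \<forall>y \<in> carrier G. x \<otimes>\<^bsub>G\<^esub> y = y \<otimes>\<^bsub>G\<^esub> x}"

definition commutator_subgroup :: "('a, 'b) monoid_scheme \<Rightarrow> 'a set" where
  "commutator_subgroup G = derived G (carrier G)"

definition power_subgroup :: "nat \<Rightarrow> ('a, 'b) monoid_scheme \<Rightarrow> 'a set" where
  "power_subgroup p G = generate G ((\<lambda>h. h [^]\<^bsub>G\<^esub> p) ` carrier G)"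

definition maximal_subgroup :: "'a set \<Rightarrow> ('a, 'b) monoid_scheme \<Rightarrow> bool" where
  "maximal_subgroup M G \<longleftrightarrow>
     subgroup M G \<and> M \<noteq> carrier G \<and>
     (\<forall>L. subgroup L G \<longrightarrow> M \<subseteq> L \<longrightarrow> L = M \<or> L = carrier G)"

text \<open>The intersection with \<open>carrier G\<close> makes the Frattini subgroup the whole group when
  there are no maximal subgroups.\<close>
definition frattini :: "('a, 'b) monoid_scheme \<Rightarrow> 'a set" where
  "frattini G = carrier G \<inter> \<Inter> {M. maximal_subgroup M G}"

definition p_group :: "nat \<Rightarrow> ('a, 'b) monoid_scheme \<Rightarrow> bool" where
  "p_group p G \<longleftrightarrow> group G \<and> (\<forall>x \<in> carrier G. \<exists>k::nat. group.ord G x = p ^ k)"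

definition special :: "('a, 'b) monoid_scheme \<Rightarrow> bool" where
  "special G \<longleftrightarrow>
     center G = commutator_subgroup G \<and> commutator_subgroup G = frattini G"

definition miller_group :: "('a, 'b) monoid_scheme \<Rightarrow> bool" where
  "miller_group G \<longleftrightarrow> group G \<and> \<not> comm_group G \<and> comm_group (AutoGroup G)"

text \<open>The map \<open>hH' \<mapsto> h\<^sup>p\<close> on cosets of the commutator subgroup, written with \<^const>\<open>the_elem\<close>
  like the maps induced on \<^const>\<open>FactGroup\<close> in the library. It has this meaning whenever \<open>h\<^sup>p\<close>
  depends only on the coset of \<open>h\<close>, as it does for special \<open>p\<close>-groups with \<open>p\<close> odd.\<close>
definition coset_power_map :: "nat \<Rightarrow> ('a, 'b) monoid_scheme \<Rightarrow> 'a set \<Rightarrow> 'a" where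
  "coset_power_map p G C = the_elem ((\<lambda>h. h [^]\<^bsub>G\<^esub> p) ` C)"

definition amalgamated_semidirect_product ::
    "('a, 'b) monoid_scheme \<Rightarrow> 'a set \<Rightarrow> 'a set \<Rightarrow> 'a set \<Rightarrow> bool" where
  "amalgamated_semidirect_product G H K M \<longleftrightarrow>
     H \<lhd> G \<and> subgroup K G \<and> carrier G = H <#>\<^bsub>G\<^esub> K \<and> H \<inter> K = M"

end

theory Submission
  imports Defs
begin

text \<open>Write \<open>D = H'\<close> and \<open>Z = \<langle>z\<rangle>\<close>. Since \<open>H\<close> is special, \<open>p\<close>-th powers of elements of \<open>H\<close> lie in
  \<open>\<Phi>(H) = Z(H) = D\<close>, so \<open>D\<close> has exponent \<open>p\<close>; moreover \<open>G\<^sub>1' = D\<close> and \<open>Z(G\<^sub>1) = D Z\<close>.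
  An automorphism \<open>f\<close> of \<open>G\<^sub>1\<close> preserves \<open>M = Z(G\<^sub>1)\<^sup>p\<close>, and composing it with \<open>G\<^sub>1 \<rightarrow> G\<^sub>1/Z \<cong> H/M\<close>
  gives an automorphism of \<open>H/M\<close>. As \<open>Aut(H/M)\<close> is abelian, that automorphism is central, i.e. trivial
  modulo \<open>Z(H/M) = D/M\<close>. Hence \<open>f\<close> is a central automorphism of \<open>G\<^sub>1\<close> and so fixes \<open>D\<close> pointwise. If
  \<open>f h = h d z\<^sup>i\<close> with \<open>d \<in> D\<close>, then comparing \<open>p\<close>-th powers gives \<open>z\<^sup>p\<^sup>i = 1\<close>, so \<open>z\<^sup>i \<in> M \<subseteq> D\<close>; likewise
  \<open>f z \<in> z D\<close>. Automorphisms that fix \<open>D\<close> and move every element within its \<open>D\<close>-coset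
  commute because \<open>D\<close> is abelian.\<close>

section \<open>Derived subgroup, p-th powers and the Frattini subgroup\<close>

lemma (in group) mult_inv_cancel:
  assumes "x \<in> carrier G" "y \<in> carrier G"
  shows "inv x \<otimes> (x \<otimes> y) = y" "x \<otimes> (inv x \<otimes> y) = y"
  using assms by (simp_all flip: m_assoc)

lemma (in group) normal_if_derived_subset:
  assumes "subgroup N G" "derived G (carrier G) \<subseteq> N"
  shows "N \<lhd> G"
proof (rule normal_invI[OF assms(1)])
  fix x h assume x: "x \<in> carrier G" and h: "h \<in> N"
  have hc: "h \<in> carrier G" using h assms(1) by (rule subgroup.mem_carrier[rotated])
  have "x \<otimes> h \<otimes> inv x \<otimes> inv h \<in> N"
    using assms(2) x hc unfolding derived_def by (blast intro: generate.incl)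
  then have "x \<otimes> h \<otimes> inv x \<otimes> inv h \<otimes> h \<in> N"
    using h assms(1) by (simp add: subgroup.m_closed)
  then show "x \<otimes> h \<otimes> inv x \<in> N"
    using x hc by (simp add: m_assoc)
qed

text \<open>By Bezout, x is itself a power of x^k, since the multiple of \<open>ord x\<close> in the
  exponent contributes the identity.\<close>

lemma (in group) int_pow_coprime_mem_subgroup:
  assumes N: "subgroup N G" and x: "x \<in> carrier G"
    and "x [^] (k :: int) \<in> N" "coprime k (int (ord x))"
  shows "x \<in> N"
proof -
  obtain u v where uv: "u * k + v * int (ord x) = 1"
    using assms(4) by (metis bezout_int coprime_iff_gcd_eq_1)
  have "x = x [^] (k * u + int (ord x) * v)"
    using uv x by (simp add: mult.commute int_pow_1)
  also have "\<dots> = (x [^] k) [^] u \<otimes> (x [^] int (ord x)) [^] v"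
    using x by (simp add: int_pow_mult int_pow_pow)
  also have "x [^] int (ord x) = \<one>"
    using x by (simp add: int_pow_int)
  finally have "x = (x [^] k) [^] u"
    using x by simp
  then show ?thesis
    using subgroup_int_pow_closed[OF N assms(3)] by metis
qed

text \<open>A maximal subgroup N contains the Frattini subgroup, hence the derived subgroup, and is
  therefore normal. So N K is a subgroup for K generated by x^p, and by maximality it is N or the
  whole group. In the first case x^p is in N. In the second x itself is forced into N, so the index
  of N never has to be computed.\<close>

lemma (in group) pow_prime_mem_frattini:
  assumes "Factorial_Ring.prime p" "p_group p G"
    and sub: "derived G (carrier G) \<subseteq> frattini G" and x: "x \<in> carrier G"
  shows "x [^] p \<in> frattini G"
proof -
  have "x [^] p \<in> N" if N: "maximal_subgroup N G" for N
  proof (cases "x \<in> N")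
    case True
    then show ?thesis
      using N subgroup_int_pow_closed[of N x "int p"]
      by (simp add: maximal_subgroup_def int_pow_int)
  next
    case False
    have sN: "subgroup N G" and nN: "N \<lhd> G"
      using N sub by (auto simp: maximal_subgroup_def frattini_def intro!: normal_if_derived_subset)
    define K where "K = generate G {x [^] p}"
    have sK: "subgroup K G"
      unfolding K_def using x by (intro generate_is_subgroup) auto
    have "subgroup (N <#> K) G"
      by (rule mult_norm_subgroup[OF nN sK])
    moreover have NK: "N \<subseteq> N <#> K"
      using subgroup.one_closed[OF sK] subgroup.mem_carrier[OF sN]
      by (force simp: set_mult_def)
    ultimately consider "N <#> K = N" | "N <#> K = carrier G"
      using N unfolding maximal_subgroup_def by blast
    then show ?thesis
    proof cases
      case 1
      have "\<one> \<otimes> x [^] p \<in> N <#> K"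
        unfolding set_mult_def K_def
        using subgroup.one_closed[OF sN] generate.incl[of "x [^] p" "{x [^] p}"] by blast
      then show ?thesis
        using 1 x by simp
    next
      case 2
      then have "x \<in> N <#> K" using x by simp
      then obtain n k where n: "n \<in> N" and eq: "x = n \<otimes> (x [^] p) [^] (k :: int)"
        unfolding set_mult_def K_def using x generate_pow[of "x [^] p"] by clarsimp metis
      have nc: "n \<in> carrier G"
        using n sN by (rule subgroup.mem_carrier[rotated])
      have e: "(x [^] p) [^] k = x [^] (int p * k)"
        using x by (simp add: int_pow_pow int_pow_int flip: int_pow_int)
      \<comment> \<open>The equation x = n x^(pk) says that n is a power of x. Its exponent is 1
        modulo p, hence coprime to the order of x, which is a power of p.\<close>
      have "x [^] (1 - int p * k) = x \<otimes> inv ((x [^] p) [^] k)"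
        using x by (simp add: int_pow_diff int_pow_1 e)
      also have "\<dots> = n"
        using eq nc x by (metis inv_solve_right int_pow_closed nat_pow_closed)
      finally have "x [^] (1 - int p * k) \<in> N"
        using n by simp
      moreover have "coprime (1 - int p * k) (int (ord x))"
      proof -
        obtain m where m: "ord x = p ^ m"
          using assms(2) x by (auto simp: p_group_def)
        have "coprime (1 - int p * k) (int p)"
        proof (rule coprimeI)
          fix c assume "c dvd 1 - int p * k" "c dvd int p"
          then have "c dvd (1 - int p * k) + int p * k" by (meson dvd_add dvd_mult2)
          then show "is_unit c" by simp
        qed
        then show ?thesis by (simp add: m)
      qed
      ultimately have "x \<in> N"
        using int_pow_coprime_mem_subgroup[OF sN x] by blast
      with False show ?thesis by contradiction
    qed
  qed
  then show ?thesis
    using x by (auto simp: frattini_def)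
qed

text \<open>For a commutator h = [x,y], conjugating y by x multiplies it by the central element h.
  The n-th power of the conjugate is then h^n y^n, but it is also y^n because y^n is central.
  Products of commutators follow because the derived subgroup is central.\<close>

lemma (in group) derived_exponent:
  assumes pow: "\<And>x. x \<in> carrier G \<Longrightarrow> x [^] (n :: nat) \<in> center G"
    and sub: "derived G (carrier G) \<subseteq> center G"
    and c: "c \<in> derived G (carrier G)"
  shows "c [^] n = \<one>"
proof -
  have comm: "x \<otimes> y = y \<otimes> x" if "x \<in> derived G (carrier G)" "y \<in> carrier G" for x y
    using that sub by (auto simp: center_def)
  have car: "x \<in> carrier G" if "x \<in> derived G (carrier G)" for x
    using that sub by (auto simp: center_def)
  have base: "h [^] n = \<one>" if "h \<in> derived_set G (carrier G)" for h
  proof -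
    obtain x y where xy: "x \<in> carrier G" "y \<in> carrier G" and h: "h = x \<otimes> y \<otimes> inv x \<otimes> inv y"
      using \<open>h \<in> derived_set G (carrier G)\<close> by auto
    have hD: "h \<in> derived G (carrier G)"
      using that unfolding derived_def by (rule generate.incl)
    have hc: "h \<in> carrier G" using xy h by simp
    have conj_pow: "(x \<otimes> y \<otimes> inv x) [^] k = x \<otimes> y [^] k \<otimes> inv x" for k :: nat
    proof (induction k)
      case (Suc k)
      then show ?case using xy by (simp add: m_assoc mult_inv_cancel)
    qed (use xy in simp)
    have "x \<otimes> y \<otimes> inv x = h \<otimes> y"
      using xy h by (simp add: m_assoc)
    then have "x \<otimes> y [^] n \<otimes> inv x = (h \<otimes> y) [^] n"
      using conj_pow[of n] by simp
    also have "\<dots> = h [^] n \<otimes> y [^] n"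
      using comm[OF hD xy(2)] hc xy by (intro pow_mult_distrib)
    finally have "x \<otimes> y [^] n \<otimes> inv x = h [^] n \<otimes> y [^] n" .
    moreover have "x \<otimes> y [^] n \<otimes> inv x = y [^] n"
      using pow[OF xy(2)] xy by (simp add: center_def m_assoc mult_inv_cancel)
    ultimately show ?thesis
      using hc xy by simp
  qed
  from c show ?thesis unfolding derived_def
  proof (induction rule: generate.induct)
    case (inv h)
    then have "h \<in> carrier G" by auto
    then show ?case using base[OF inv] by (simp add: nat_pow_inv)
  next
    case (eng a b)
    note ab = eng.hyps[folded derived_def]
    have "(a \<otimes> b) [^] n = a [^] n \<otimes> b [^] n"
      using comm[OF ab(1) car[OF ab(2)]] car ab by (intro pow_mult_distrib) auto
    then show ?case by (simp add: eng.IH)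
  qed (use base in auto)
qed

section \<open>The center and commuting automorphisms\<close>

lemma (in group) subgroup_center: "subgroup (center G) G"
proof (rule subgroupI)
  fix a assume a: "a \<in> center G"
  have "inv a \<otimes> x = x \<otimes> inv a" if "x \<in> carrier G" for x
  proof -
    have ac: "a \<in> carrier G" and "x \<otimes> a = a \<otimes> x"
      using a that by (simp_all add: center_def)
    then have "inv a \<otimes> (x \<otimes> a) \<otimes> inv a = x \<otimes> inv a"
      using that by (simp add: m_assoc mult_inv_cancel)
    then show ?thesis
      using ac that by (simp add: m_assoc)
  qed
  with a show "inv a \<in> center G" by (simp add: center_def)
next
  fix a b assume ab: "a \<in> center G" "b \<in> center G"
  then have car: "a \<in> carrier G" "b \<in> carrier G" by (auto simp: center_def)
  have "a \<otimes> b \<otimes> x = x \<otimes> (a \<otimes> b)" if x: "x \<in> carrier G" for x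
  proof -
    have c: "a \<otimes> x = x \<otimes> a" "b \<otimes> x = x \<otimes> b"
      using ab x by (simp_all add: center_def)
    have "a \<otimes> b \<otimes> x = a \<otimes> x \<otimes> b" using car x by (simp add: m_assoc c(2))
    then show ?thesis using car x by (simp add: m_assoc c(1))
  qed
  then show "a \<otimes> b \<in> center G"
    using car by (simp add: center_def)
qed (auto simp: center_def intro: exI[of _ \<one>])

lemma mult_AutoGroup:
  "\<lbrakk>f \<in> auto G; g \<in> auto G\<rbrakk> \<Longrightarrow> f \<otimes>\<^bsub>AutoGroup G\<^esub> g = compose (carrier G) f g"
  by (simp add: AutoGroup_def BijGroup_def auto_def)

lemma (in group) inner_in_auto:
  assumes a: "a \<in> carrier G"
  shows "(\<lambda>x\<in>carrier G. a \<otimes> x \<otimes> inv a) \<in> auto G"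
proof -
  have hom: "(\<lambda>x\<in>carrier G. a \<otimes> x \<otimes> inv a) \<in> hom G G"
  proof (rule homI)
    fix x y assume xy: "x \<in> carrier G" "y \<in> carrier G"
    then show "(\<lambda>x\<in>carrier G. a \<otimes> x \<otimes> inv a) (x \<otimes> y) =
      (\<lambda>x\<in>carrier G. a \<otimes> x \<otimes> inv a) x \<otimes> (\<lambda>x\<in>carrier G. a \<otimes> x \<otimes> inv a) y"
      using a by (simp add: m_assoc mult_inv_cancel)
  qed (use a in simp)
  have "bij_betw (\<lambda>x. a \<otimes> x \<otimes> inv a) (carrier G) (carrier G)"
    by (rule bij_betw_byWitness[where f' = "\<lambda>x. inv a \<otimes> x \<otimes> a"])
      (use a in \<open>auto simp: m_assoc mult_inv_cancel\<close>)
  then have "(\<lambda>x\<in>carrier G. a \<otimes> x \<otimes> inv a) \<in> Bij (carrier G)"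
    by (simp add: Bij_def)
  with hom show ?thesis by (simp add: auto_def)
qed

text \<open>Commuting with conjugation by \<open>x\<close> forces \<open>f x\<close> and \<open>x\<close> to induce the same inner automorphism.\<close>
lemma (in group) auto_central_if_comm:
  assumes "comm_group (AutoGroup G)" and f: "f \<in> auto G" and x: "x \<in> carrier G"
  shows "inv x \<otimes> f x \<in> center G"
proof -
  interpret f: group_hom G G f
    using f by unfold_locales (simp add: auto_def)
  define i where "i = (\<lambda>y\<in>carrier G. x \<otimes> y \<otimes> inv x)"
  have i: "i \<in> auto G" unfolding i_def by (rule inner_in_auto[OF x])
  have surj: "f ` carrier G = carrier G"
    using f by (simp add: auto_def Bij_def bij_betw_def)
  have "f \<otimes>\<^bsub>AutoGroup G\<^esub> i = i \<otimes>\<^bsub>AutoGroup G\<^esub> f"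
    using f i by (intro comm_groupE(4)[OF assms(1)]) (auto simp: AutoGroup_def)
  then have eq: "compose (carrier G) f i = compose (carrier G) i f"
    by (simp add: mult_AutoGroup f i)
  have "inv x \<otimes> f x \<otimes> y = y \<otimes> (inv x \<otimes> f x)" if y: "y \<in> carrier G" for y
  proof -
    obtain w where w: "w \<in> carrier G" "y = f w" using surj y by auto
    have "f (i w) = i (f w)"
      using fun_cong[OF eq, of w] w by (simp add: compose_def)
    then have e: "f x \<otimes> y \<otimes> inv (f x) = x \<otimes> y \<otimes> inv x"
      using w x by (simp add: i_def)
    have "f x \<otimes> y = f x \<otimes> y \<otimes> inv (f x) \<otimes> f x"
      using x y by (simp add: m_assoc)
    also have "\<dots> = x \<otimes> y \<otimes> inv x \<otimes> f x" by (simp add: e)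
    finally have "f x \<otimes> y = x \<otimes> (y \<otimes> (inv x \<otimes> f x))"
      using x y by (simp add: m_assoc)
    then have "inv x \<otimes> (f x \<otimes> y) = y \<otimes> (inv x \<otimes> f x)"
      using x y by (simp add: m_assoc[symmetric])
    then show ?thesis using x y by (simp add: m_assoc)
  qed
  then show ?thesis using x by (simp add: center_def)
qed

text \<open>Central factors cancel in commutators: [xc, yd] = [x,y] when c and d are central. So
  every generator of the derived subgroup is fixed.\<close>

lemma (in group) central_hom_fixes_derived:
  assumes h: "h \<in> hom G G" and cent: "\<And>x. x \<in> carrier G \<Longrightarrow> \<exists>c\<in>center G. h x = x \<otimes> c"
    and "x \<in> derived G (carrier G)"
  shows "h x = x"
proof -
  interpret h: group_hom G G h
    using h by unfold_locales
  have mid: "a \<otimes> c \<otimes> b = a \<otimes> b \<otimes> c" if "a \<in> carrier G" "b \<in> carrier G" "c \<in> center G" for a b c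
    using that by (simp add: center_def m_assoc)
  have base: "h k = k" if "k \<in> derived_set G (carrier G)" for k
  proof -
    obtain x y where xy: "x \<in> carrier G" "y \<in> carrier G" and k: "k = x \<otimes> y \<otimes> inv x \<otimes> inv y"
      using \<open>k \<in> derived_set G (carrier G)\<close> by auto
    obtain c d where c: "c \<in> center G" "h x = x \<otimes> c" and d: "d \<in> center G" "h y = y \<otimes> d"
      using cent xy by meson
    have cd: "c \<in> carrier G" "d \<in> carrier G" using c d by (auto simp: center_def)
    have "h k = (x \<otimes> c) \<otimes> (y \<otimes> d) \<otimes> inv (x \<otimes> c) \<otimes> inv (y \<otimes> d)"
      using xy k c d by simp
    also have "\<dots> = k"
    proof -
      have "(x \<otimes> c) \<otimes> (y \<otimes> d) \<otimes> inv (x \<otimes> c) \<otimes> inv (y \<otimes> d) = x \<otimes> c \<otimes> (y \<otimes> d) \<otimes> (inv c \<otimes> inv x) \<otimes> (inv d \<otimes> inv y)"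
        using xy cd by (simp add: inv_mult_group)
      also have "\<dots> = x \<otimes> (y \<otimes> d) \<otimes> c \<otimes> inv c \<otimes> inv x \<otimes> inv d \<otimes> inv y"
        using mid[of x "y \<otimes> d" c] xy cd c(1) by (simp add: m_assoc mult_inv_cancel)
      also have "\<dots> = x \<otimes> y \<otimes> d \<otimes> inv x \<otimes> inv d \<otimes> inv y"
        using xy cd by (simp add: m_assoc)
      also have "\<dots> = x \<otimes> y \<otimes> inv x \<otimes> d \<otimes> inv d \<otimes> inv y"
        using mid[of "x \<otimes> y" "inv x" d] xy cd d by simp
      also have "\<dots> = k"
        using xy cd k by (simp add: m_assoc)
      finally show ?thesis .
    qed
    finally show ?thesis .
  qed
  from assms(3) show ?thesis unfolding derived_def
  proof (induction rule: generate.induct)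
    case (inv k)
    then have "k \<in> carrier G" by auto
    then show ?case using base[OF inv] by simp
  next
    case (eng a b)
    then have "a \<in> carrier G" "b \<in> carrier G"
      using derived_in_carrier[of "carrier G"] unfolding derived_def by auto
    then show ?case using eng.IH by simp
  qed (use base in auto)
qed

lemma (in group) comm_AutoGroupI:
  assumes central: "\<And>d x. \<lbrakk>d \<in> D; x \<in> D\<rbrakk> \<Longrightarrow> d \<otimes> x = x \<otimes> d" and D: "D \<subseteq> carrier G"
    and shift: "\<And>f x. \<lbrakk>f \<in> auto G; x \<in> carrier G\<rbrakk> \<Longrightarrow> \<exists>d\<in>D. f x = x \<otimes> d"
    and fix_D: "\<And>f d. \<lbrakk>f \<in> auto G; d \<in> D\<rbrakk> \<Longrightarrow> f d = d"
  shows "comm_group (AutoGroup G)"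
proof (rule group.group_comm_groupI[OF AutoGroup])
  fix f g assume "f \<in> carrier (AutoGroup G)" "g \<in> carrier (AutoGroup G)"
  then have fg: "f \<in> auto G" "g \<in> auto G" by (simp_all add: AutoGroup_def)
  have "f (g x) = g (f x)" if x: "x \<in> carrier G" for x
  proof -
    \<comment> \<open>Since f fixes b and g fixes a, the two composites send x to x a b and x b
      a.\<close>
    obtain a b where a: "a \<in> D" "f x = x \<otimes> a" and b: "b \<in> D" "g x = x \<otimes> b"
      using shift fg x by meson
    have "f (g x) = x \<otimes> a \<otimes> b"
      using fg(1) x a b D fix_D[OF fg(1) b(1)] by (auto simp: auto_def hom_def)
    moreover have "g (f x) = x \<otimes> b \<otimes> a"
      using fg(2) x a b D fix_D[OF fg(2) a(1)] by (auto simp: auto_def hom_def)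
    ultimately show ?thesis
      using central[OF a(1) b(1)] a(1) b(1) x D by (simp add: m_assoc subset_iff)
  qed
  then show "f \<otimes>\<^bsub>AutoGroup G\<^esub> g = g \<otimes>\<^bsub>AutoGroup G\<^esub> f"
    by (auto simp: mult_AutoGroup fg compose_def)
qed


section \<open>The amalgam: its center, derived subgroup and p-th powers\<close>

text \<open>Specialness of H enters through three consequences, phrased with the operations of
  \<open>G\<close>: \<open>center_H\<close>, \<open>D_exponent\<close> and \<open>H_pow\<close>. The
  final theorem derives them from the equality of center, derived subgroup and Frattini
  subgroup.\<close>

locale cyclic_central_amalgam = group G for G (structure) +
  fixes H Z D M :: "'a set" and z :: 'a and p :: nat
  defines "Z \<equiv> generate G {z}" and "D \<equiv> derived G H" and "M \<equiv> H \<inter> Z"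
  assumes subgroup_H: "subgroup H G" and finite_H: "finite H"
    and prime_p: "Factorial_Ring.prime p"
    and z_closed: "z \<in> carrier G" and ord_z: "ord z = p ^ 2"
    and z_comm: "h \<in> H \<Longrightarrow> z \<otimes> h = h \<otimes> z"
    and carrier_eq: "carrier G = H <#> Z"
    and M_eq: "M = generate G {z [^] p}"
    and M_sub: "M \<subseteq> D"
    and center_H: "center (G\<lparr>carrier := H\<rparr>) = D"
    and D_exponent: "d \<in> D \<Longrightarrow> d [^] p = \<one>"
    and H_pow: "h \<in> H \<Longrightarrow> h [^] p \<in> D"
begin

lemma subgroup_Z: "subgroup Z G"
  unfolding Z_def using z_closed by (intro generate_is_subgroup) auto

lemma subgroup_M: "subgroup M G"
  unfolding M_def using subgroup_H subgroup_Z by (rule subgroups_Inter_pair)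

lemma D_sub_H: "D \<subseteq> H"
  unfolding D_def using subgroup_H by (intro derived_incl) auto

lemma subgroup_D: "subgroup D G"
  unfolding D_def using subgroup_H by (intro derived_is_subgroup subgroup.subset)

lemma mem_carrier [simp]:
  "h \<in> H \<Longrightarrow> h \<in> carrier G" "k \<in> Z \<Longrightarrow> k \<in> carrier G" "d \<in> D \<Longrightarrow> d \<in> carrier G"
  using subgroup_H subgroup_Z subgroup_D by (auto dest: subgroup.mem_carrier)

lemma decomposeE:
  assumes "x \<in> carrier G"
  obtains h k where "h \<in> H" "k \<in> Z" "x = h \<otimes> k"
  using assms unfolding carrier_eq set_mult_def by auto

lemma p_pos: "0 < p"
  using prime_p by (rule prime_gt_0_nat)

text \<open>Natural exponents suffice because z has the nonzero order p^2.\<close>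

lemma Z_eq: "Z = {z [^] n | n. n \<in> (UNIV :: nat set)}"
  unfolding Z_def using z_closed ord_z p_pos by (intro generate_pow_nat) auto

lemma Z_sub_center: "Z \<subseteq> center G"
proof
  fix k assume k: "k \<in> Z"
  have comm: "a \<otimes> b = b \<otimes> a" if "a \<in> Z" "b \<in> Z" for a b
  proof -
    obtain m n :: nat where mn: "a = z [^] m" "b = z [^] n" using \<open>a \<in> Z\<close> \<open>b \<in> Z\<close> unfolding Z_eq by auto
    show ?thesis
      unfolding mn using z_closed by (simp add: nat_pow_mult add.commute)
  qed
  have kH: "k \<otimes> h = h \<otimes> k" if "h \<in> H" for h
  proof -
    obtain m :: nat where m: "k = z [^] m" using k unfolding Z_eq by auto
    have "z [^] m \<otimes> h = h \<otimes> z [^] m"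
    proof (induction m)
      case (Suc m)
      have "z [^] Suc m \<otimes> h = (z [^] m \<otimes> h) \<otimes> z"
        using that z_closed z_comm[OF that] by (simp add: m_assoc)
      then show ?case using Suc that z_closed by (simp add: m_assoc)
    qed (use that in simp)
    then show ?thesis by (simp add: m)
  qed
  have "k \<otimes> x = x \<otimes> k" if "x \<in> carrier G" for x
  proof -
    obtain h l where x: "h \<in> H" "l \<in> Z" "x = h \<otimes> l" using \<open>x \<in> carrier G\<close> by (rule decomposeE)
    have "k \<otimes> x = h \<otimes> (k \<otimes> l)"
      using x k kH[of h] by (simp flip: m_assoc)
    then show ?thesis
      using x k comm[of k l] by (simp add: m_assoc)
  qed
  then show "k \<in> center G" using k by (simp add: center_def)
qed

lemma D_sub_center: "D \<subseteq> center G"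
proof
  fix d assume d: "d \<in> D"
  have dH: "d \<otimes> h = h \<otimes> d" if "h \<in> H" for h
    using d that unfolding center_H[symmetric] by (simp add: center_def)
  have "d \<otimes> x = x \<otimes> d" if "x \<in> carrier G" for x
  proof -
    obtain h l where x: "h \<in> H" "l \<in> Z" "x = h \<otimes> l" using \<open>x \<in> carrier G\<close> by (rule decomposeE)
    have "d \<otimes> x = h \<otimes> (d \<otimes> l)"
      using x d dH[of h] by (simp flip: m_assoc)
    also have "d \<otimes> l = l \<otimes> d"
      using x(2) d Z_sub_center by (auto simp: center_def)
    finally show ?thesis
      using x d by (simp add: m_assoc)
  qed
  then show "d \<in> center G" using d by (simp add: center_def)
qed

lemma D_if_central: "\<lbrakk>h \<in> H; h \<in> center G\<rbrakk> \<Longrightarrow> h \<in> D"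
  unfolding center_H[symmetric] by (simp add: center_def)

text \<open>If h k is central with k in Z, then h is central too, because Z is central. A central
  element lying in H is in the center of H, which is D.\<close>

lemma centerE:
  assumes "x \<in> center G"
  obtains d k where "d \<in> D" "k \<in> Z" "x = d \<otimes> k"
proof -
  have xc: "x \<in> carrier G" using assms by (simp add: center_def)
  obtain h k where x: "h \<in> H" "k \<in> Z" "x = h \<otimes> k" using xc by (rule decomposeE)
  have "h = x \<otimes> inv k" using x by (simp add: m_assoc)
  then have "h \<in> center G"
    using assms x Z_sub_center subgroup_center by (metis subgroup.m_closed subgroup.m_inv_closed subsetD)
  then have "h \<in> D" using x by (intro D_if_central)
  then show thesis using x that by blast
qed

text \<open>The components in Z are central and cancel, so the commutator of h k and h' k' is that
  of h and h'.\<close>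

lemma derived_carrier: "derived G (carrier G) = D"
proof
  show "D \<subseteq> derived G (carrier G)"
    unfolding D_def using subgroup_H by (intro mono_derived subgroup.subset)
  have "derived_set G (carrier G) \<subseteq> D"
  proof clarify
    fix x y assume "x \<in> carrier G" "y \<in> carrier G"
    then obtain h k h' k' where x: "h \<in> H" "k \<in> Z" "x = h \<otimes> k" and y: "h' \<in> H" "k' \<in> Z" "y = h' \<otimes> k'"
      by (metis decomposeE)
    have ck: "u \<otimes> k = k \<otimes> u" and ck': "u \<otimes> k' = k' \<otimes> u" if "u \<in> carrier G" for u
      using x(2) y(2) Z_sub_center that by (auto simp: center_def)
    have xy: "x \<otimes> y = h \<otimes> h' \<otimes> (k \<otimes> k')"
      using x y ck[of h'] by (simp add: m_assoc) (simp add: ck flip: m_assoc)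
    have yx: "y \<otimes> x = h' \<otimes> h \<otimes> (k \<otimes> k')"
      using x y ck'[of h] ck'[of k] by (simp add: m_assoc) (simp add: ck' flip: m_assoc)
    have "x \<otimes> y \<otimes> inv x \<otimes> inv y = (x \<otimes> y) \<otimes> inv (y \<otimes> x)"
      using x y by (simp add: inv_mult_group m_assoc)
    also have "\<dots> = h \<otimes> h' \<otimes> (k \<otimes> k') \<otimes> (inv (k \<otimes> k') \<otimes> inv (h' \<otimes> h))"
      unfolding xy yx using x y by (simp add: inv_mult_group)
    also have "\<dots> = h \<otimes> h' \<otimes> inv h \<otimes> inv h'"
      using x y by (simp add: inv_mult_group m_assoc mult_inv_cancel)
    also have "\<dots> \<in> D"
      unfolding D_def derived_def using x y by (blast intro: generate.incl)
    finally show "x \<otimes> y \<otimes> inv x \<otimes> inv y \<in> D" .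
  qed
  then show "derived G (carrier G) \<subseteq> D"
    unfolding derived_def[of G "carrier G"] by (rule generate_subgroup_incl) (rule subgroup_D)
qed

text \<open>Describing M by p-th powers makes it accessible to automorphisms, which need not
  preserve Z.\<close>

lemma pow_eq_M: "M = (\<lambda>k. k [^] p) ` Z"
proof -
  have "ord (z [^] p) \<noteq> 0"
  proof -
    have "(z [^] p) [^] p = \<one>"
      using z_closed pow_eq_id[OF z_closed, of "p * p"] by (simp add: nat_pow_pow ord_z power2_eq_square)
    then have "ord (z [^] p) dvd p" using pow_eq_id[of "z [^] p" p] z_closed by simp
    then show ?thesis using p_pos dvd_pos_nat by fastforce
  qed
  then have "M = {(z [^] p) [^] n | n. n \<in> (UNIV :: nat set)}"
    unfolding M_eq using z_closed by (intro generate_pow_nat) auto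
  also have "\<dots> = {(z [^] n) [^] p | n. n \<in> (UNIV :: nat set)}"
    using z_closed by (simp add: nat_pow_pow mult.commute)
  finally show ?thesis
    unfolding Z_eq by blast
qed

text \<open>If z^(np) = 1, then p^2 divides np, so p divides n and z^n is a power of z^p.\<close>

lemma Z_torsion:
  assumes "k \<in> Z" "k [^] p = \<one>"
  shows "k \<in> M"
proof -
  obtain n :: nat where n: "k = z [^] n" using assms(1) unfolding Z_eq by auto
  have "p * p dvd n * p"
    using assms(2) z_closed pow_eq_id[OF z_closed, of "n * p"]
    by (simp add: n nat_pow_pow ord_z power2_eq_square)
  then obtain m where "n = p * m" using p_pos by auto
  then have "k = (z [^] m) [^] p" using n z_closed by (simp add: nat_pow_pow mult.commute)
  then show ?thesis unfolding pow_eq_M Z_eq by blast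
qed

text \<open>The factors d and k are central, so the power distributes, and d^p = 1. Taking p-th
  powers thus erases the D-component and isolates the one in Z.\<close>

lemma pow_central_mult:
  assumes "x \<in> carrier G" "d \<in> D" "k \<in> Z"
  shows "(x \<otimes> d \<otimes> k) [^] p = x [^] p \<otimes> k [^] p"
proof -
  have "d \<in> center G" "k \<in> center G"
    using assms D_sub_center Z_sub_center by auto
  then have c: "x \<otimes> d = d \<otimes> x" "x \<otimes> d \<otimes> k = k \<otimes> (x \<otimes> d)"
    using assms by (simp_all add: center_def)
  show ?thesis
    using assms by (simp add: pow_mult_distrib[OF c(2)] pow_mult_distrib[OF c(1)] D_exponent)
qed

text \<open>Otherwise z would lie in M, hence in D, which has exponent p, while z has order
  p^2.\<close>

lemma z_notin_H: "z \<notin> H"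
proof
  assume "z \<in> H"
  then have "z \<in> M" by (simp add: M_def Z_def generate.incl)
  then have "z \<in> D" using M_sub by auto
  then have "p ^ 2 dvd p"
    using D_exponent pow_eq_id[OF z_closed, of p] by (simp add: ord_z)
  then have "p ^ 2 \<le> p" using p_pos by (rule dvd_imp_le)
  then show False using prime_gt_1_nat[OF prime_p] by (simp add: power2_eq_square)
qed

lemma not_special: "\<not> special G"
proof
  assume "special G"
  then have "center G = D" by (simp add: special_def commutator_subgroup_def derived_carrier)
  moreover have "z \<in> center G" using Z_sub_center by (auto simp: Z_def generate.incl)
  ultimately show False using z_notin_H D_sub_H by auto
qed

section \<open>The quotient by Z, realised as H/M\<close>

text \<open>The map \<open>G \<rightarrow> G/Z \<cong> H/M\<close>.\<close>
definition proj :: "'a \<Rightarrow> 'a set" where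
  "proj x = H \<inter> (Z #> x)"

text \<open>An element l h k of the coset of Z lies in H exactly when l k lies in the intersection
  of H and Z, which is M. So \<open>proj\<close> takes values in H/M and does not depend on the
  decomposition chosen.\<close>

lemma proj_mult:
  assumes "h \<in> H" "k \<in> Z"
  shows "proj (h \<otimes> k) = M #> h"
proof -
  have ck: "h \<otimes> k = k \<otimes> h"
    using assms Z_sub_center by (auto simp: center_def)
  have "y \<in> M #> h" if "y \<in> H" "l \<in> Z" "y = l \<otimes> (h \<otimes> k)" for y l
  proof -
    have y: "y = (l \<otimes> k) \<otimes> h" using that assms ck by (simp add: m_assoc)
    then have "l \<otimes> k = y \<otimes> inv h" using that assms by (simp add: m_assoc)
    moreover have "y \<otimes> inv h \<in> H"
      using that assms subgroup_H by (simp add: subgroup.m_closed subgroup.m_inv_closed)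
    moreover have "l \<otimes> k \<in> Z" using that assms subgroup_Z by (simp add: subgroup.m_closed)
    ultimately have "l \<otimes> k \<in> M" by (simp add: M_def)
    then show ?thesis unfolding r_coset_def using y by blast
  qed
  moreover have "m \<otimes> h \<in> proj (h \<otimes> k)" if "m \<in> M" for m
  proof -
    have m: "m \<in> H" "m \<in> Z" using that by (auto simp: M_def)
    have "m \<otimes> h = (m \<otimes> inv k) \<otimes> (h \<otimes> k)"
      unfolding ck using m assms by (simp add: m_assoc mult_inv_cancel)
    moreover have "m \<otimes> inv k \<in> Z"
      using m assms subgroup_Z by (simp add: subgroup.m_closed subgroup.m_inv_closed)
    moreover have "m \<otimes> h \<in> H" using m assms subgroup_H by (simp add: subgroup.m_closed)
    ultimately show ?thesis unfolding proj_def r_coset_def by blast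
  qed
  ultimately show ?thesis
    unfolding proj_def r_coset_def by blast
qed

abbreviation Q where "Q \<equiv> G\<lparr>carrier := H\<rparr> Mod M"

lemma normal_M: "M \<lhd> G\<lparr>carrier := H\<rparr>"
proof -
  interpret HG: group "G\<lparr>carrier := H\<rparr>" using subgroup_H by (rule subgroup_imp_group)
  have "subgroup M (G\<lparr>carrier := H\<rparr>)"
    unfolding M_def using subgroup_H subgroup_Z
    by (intro subgroup_incl subgroups_Inter_pair) auto
  then show ?thesis
  proof (rule HG.normal_invI)
    fix x h assume x: "x \<in> carrier (G\<lparr>carrier := H\<rparr>)" and h: "h \<in> M"
    then have "h \<in> D" using M_sub by auto
    then have "h \<otimes> x = x \<otimes> h" using D_sub_center x by (auto simp: center_def)
    then have "x \<otimes> h \<otimes> inv x = h" using x \<open>h \<in> D\<close> by (simp add: m_assoc flip: \<open>h \<otimes> x = x \<otimes> h\<close>)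
    then show "x \<otimes>\<^bsub>G\<lparr>carrier := H\<rparr>\<^esub> h \<otimes>\<^bsub>G\<lparr>carrier := H\<rparr>\<^esub> inv\<^bsub>G\<lparr>carrier := H\<rparr>\<^esub> x \<in> M"
      using h x subgroup_H by simp
  qed
qed

lemma group_Q: "group Q"
  using normal_M by (rule normal.factorgroup_is_group)

lemma rcoset_in_Q: "h \<in> H \<Longrightarrow> M #> h \<in> carrier Q"
  by (auto simp: FactGroup_def RCOSETS_def r_coset_def)

lemma mult_Q: "\<lbrakk>h \<in> H; h' \<in> H\<rbrakk> \<Longrightarrow> (M #> h) <#> (M #> h') = M #> (h \<otimes> h')"
  using normal.rcos_sum[OF normal_M, of h h'] by (simp add: FactGroup_def r_coset_def set_mult_def)

lemma proj_hom: "proj \<in> hom G Q"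
proof (rule homI)
  fix x assume "x \<in> carrier G"
  then show "proj x \<in> carrier Q" by (metis decomposeE proj_mult rcoset_in_Q)
next
  fix x y assume "x \<in> carrier G" "y \<in> carrier G"
  then obtain h k h' k' where x: "h \<in> H" "k \<in> Z" "x = h \<otimes> k" and y: "h' \<in> H" "k' \<in> Z" "y = h' \<otimes> k'"
    by (metis decomposeE)
  have ck: "k \<otimes> h' = h' \<otimes> k"
    using x(2) y(1) Z_sub_center by (auto simp: center_def)
  have "x \<otimes> y = h \<otimes> (k \<otimes> h') \<otimes> k'" using x y by (simp add: m_assoc)
  then have "x \<otimes> y = (h \<otimes> h') \<otimes> (k \<otimes> k')" using x y by (simp add: m_assoc ck)
  moreover have "h \<otimes> h' \<in> H" "k \<otimes> k' \<in> Z"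
    using x y subgroup_H subgroup_Z by (simp_all add: subgroup.m_closed)
  ultimately show "proj (x \<otimes> y) = proj x \<otimes>\<^bsub>Q\<^esub> proj y"
    using x y by (simp add: proj_mult mult_Q)
qed

text \<open>The derived subgroup of \<open>Q\<close> is the image of D. Since M is contained in D,
  every representative of a coset in that image is again in D.\<close>

lemma derived_Q:
  assumes "h \<in> H" "M #> h \<in> derived Q (carrier Q)"
  shows "h \<in> D"
proof -
  interpret HG: group "G\<lparr>carrier := H\<rparr>" using subgroup_H by (rule subgroup_imp_group)
  interpret Q: group_hom "G\<lparr>carrier := H\<rparr>" Q "\<lambda>h. M #> h"
    by (intro group_hom.intro group_hom_axioms.intro group_Q subgroup_imp_group[OF subgroup_H] homI)
      (auto simp: mult_Q rcoset_in_Q)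
  have "(\<lambda>h. M #> h) ` H = carrier Q"
    by (auto simp: FactGroup_def RCOSETS_def r_coset_def)
  then have "derived Q (carrier Q) = (\<lambda>h. M #> h) ` D"
    using Q.derived_img[of H] derived_consistent[OF _ subgroup_H, of H] by (simp add: D_def)
  then obtain d where d: "d \<in> D" "M #> h = M #> d" using assms by auto
  have "h \<in> M #> h" using assms(1) by (intro rcos_self subgroup_M) auto
  then have "h \<in> M #> d" by (simp only: d(2))
  then obtain m where "m \<in> M" "h = m \<otimes> d" unfolding r_coset_def by auto
  then show ?thesis using d M_sub subgroup_D by (auto intro: subgroup.m_closed)
qed

section \<open>The action of an automorphism on D, on M and modulo D\<close>

context
  fixes f
  assumes f: "f \<in> auto G"
begin

interpretation f: group_hom G G f
  using f by unfold_locales (simp add: auto_def)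

lemma f_bij: "bij_betw f (carrier G) (carrier G)"
  using f by (simp add: auto_def Bij_def)

lemma auto_D: "f ` D = D"
  using f.derived_img[of "carrier G"] f_bij by (simp add: derived_carrier bij_betw_def)

lemma auto_center:
  assumes "x \<in> carrier G"
  shows "f x \<in> center G \<longleftrightarrow> x \<in> center G"
proof -
  have surj: "carrier G = f ` carrier G" using f_bij by (simp add: bij_betw_def)
  \<comment> \<open>Surjectivity lets y range over images under f; injectivity then removes f from
    both sides.\<close>
  have "(\<forall>y\<in>carrier G. f x \<otimes> y = y \<otimes> f x) \<longleftrightarrow> (\<forall>y\<in>carrier G. f (x \<otimes> y) = f (y \<otimes> x))"
    using assms by (subst surj) simp
  also have "\<dots> \<longleftrightarrow> (\<forall>y\<in>carrier G. x \<otimes> y = y \<otimes> x)"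
    using assms f_bij by (metis bij_betw_def inj_onD m_closed)
  finally show ?thesis using assms by (simp add: center_def)
qed

text \<open>For k in Z the image f k is only known to be central, say d l with d in D and l in Z.
  Its p-th power is l^p, which lies in M. Finiteness of M upgrades the inclusion to
  equality.\<close>

lemma auto_M: "f ` M = M"
proof (rule endo_inj_surj)
  show "finite M" using finite_H by (simp add: M_def)
  show "inj_on f M" using f_bij by (rule inj_on_subset[OF bij_betw_imp_inj_on]) (auto simp: M_def)
  show "f ` M \<subseteq> M"
  proof
    fix y assume "y \<in> f ` M"
    then obtain k where k: "k \<in> Z" "y = f (k [^] p)" unfolding pow_eq_M by auto
    have "f k \<in> center G" using k Z_sub_center auto_center[of k] by auto
    then obtain d l where dl: "d \<in> D" "l \<in> Z" "f k = d \<otimes> l" by (rule centerE)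
    have "y = (\<one> \<otimes> d \<otimes> l) [^] p" using k dl by (simp add: f.hom_nat_pow)
    also have "\<dots> = l [^] p" using dl pow_central_mult[of \<one> d l] by simp
    finally show "y \<in> M" using dl unfolding pow_eq_M by blast
  qed
qed

text \<open>The map sending x in H to \<open>proj (f x)\<close> has kernel M, so it induces an
  injective endomorphism of the finite group \<open>Q\<close>, that is, an automorphism. As the
  automorphism group of \<open>Q\<close> is abelian, it moves each coset by a central element of
  \<open>Q\<close>, and such an element comes from D.\<close>

lemma auto_mod_Z:
  assumes comm: "comm_group (AutoGroup Q)" and cQ: "center Q = derived Q (carrier Q)"
    and h: "h \<in> H"
  obtains d k where "d \<in> D" "k \<in> Z" "f h = h \<otimes> d \<otimes> k"
proof -
  interpret Q: group Q by (rule group_Q)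
  interpret \<pi>: group_hom "G\<lparr>carrier := H\<rparr>" Q "\<lambda>x. proj (f x)"
  proof (intro group_hom.intro group_hom_axioms.intro group_Q subgroup_imp_group[OF subgroup_H])
    show "(\<lambda>x. proj (f x)) \<in> hom (G\<lparr>carrier := H\<rparr>) Q"
      using proj_hom by (auto simp: hom_def)
  qed
  have M_iff: "M #> y = M \<longleftrightarrow> y \<in> M" if "y \<in> H" for y
    using that subgroup_M coset_join1[of M y] coset_join2[of y M] by auto
  have "kernel (G\<lparr>carrier := H\<rparr>) Q (\<lambda>x. proj (f x)) = M"
  proof -
    have "proj (f x) = M \<longleftrightarrow> x \<in> M" if x: "x \<in> H" for x
    proof
      \<comment> \<open>Here f x lies in Z, so x is central and hence in D. Then f x is in D as
        well, so in both H and Z, that is, in M = f M. Injectivity of f gives x in M.\<close>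
      assume *: "proj (f x) = M"
      obtain y k where yk: "y \<in> H" "k \<in> Z" "f x = y \<otimes> k" using x by (metis decomposeE f.hom_closed mem_carrier(1))
      then have "y \<in> M" using * M_iff proj_mult by simp
      then have fZ: "f x \<in> Z" using yk subgroup_Z by (auto simp: M_def subgroup.m_closed)
      then have "x \<in> center G" using x Z_sub_center auto_center[of x] by auto
      then have "x \<in> D" using x by (intro D_if_central)
      then have "f x \<in> M" using auto_D D_sub_H fZ by (auto simp: M_def)
      then obtain m where "m \<in> M" "f x = f m" using auto_M by auto
      then show "x \<in> M"
        using f_bij x unfolding bij_betw_def by (metis IntE M_def inj_onD mem_carrier(1))
    next
      assume "x \<in> M"
      then have fx: "f x \<in> M" using auto_M by blast
      then have "proj (f x \<otimes> \<one>) = M #> f x"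
        using subgroup_Z by (intro proj_mult) (auto simp: M_def subgroup.one_closed)
      then show "proj (f x) = M" using M_iff[of "f x"] fx by (simp add: M_def)
    qed
    then show ?thesis by (auto simp: kernel_def M_def)
  qed
  note ker = this
  \<comment> \<open>The induced map on cosets, restricted to the carrier because \<open>auto\<close>
    consists of extensional functions.\<close>
  define g where "g = (\<lambda>C\<in>carrier Q. the_elem ((\<lambda>x. proj (f x)) ` C))"
  have "g \<in> hom Q Q"
    using \<pi>.FactGroup_hom unfolding ker by (rule Q.hom_restrict) (simp add: g_def)
  moreover have "g \<in> Bij (carrier Q)"
  proof -
    have inj: "inj_on g (carrier Q)"
      using \<pi>.FactGroup_inj_on unfolding ker g_def by (simp add: inj_on_def)
    have "finite (carrier Q)" using finite_H by (simp add: FactGroup_def RCOSETS_def)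
    then have "g ` carrier Q = carrier Q"
      using inj \<open>g \<in> hom Q Q\<close> by (intro endo_inj_surj) (auto simp: hom_def)
    then show ?thesis using inj by (simp add: Bij_def bij_betw_def g_def)
  qed
  ultimately have g: "g \<in> auto Q" by (simp add: auto_def)
  obtain y k where y: "y \<in> H" "k \<in> Z" "f h = y \<otimes> k"
    using h by (metis decomposeE f.hom_closed mem_carrier(1))
  have "g (M #> h) = M #> y"
  proof -
    have "(\<lambda>x. proj (f x)) ` (M #> h) = {proj (f h)}"
    proof -
      have "h \<in> M #> h" using h by (intro rcos_self subgroup_M) auto
      moreover have "proj (f (m \<otimes> h)) = proj (f h)" if "m \<in> M" for m
      proof -
        have "f m \<in> H" "f m \<in> Z" using auto_M that by (auto simp: M_def)
        moreover have "f (m \<otimes> h) = y \<otimes> (f m \<otimes> k)"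
        proof -
          have "f m \<otimes> y = y \<otimes> f m" using \<open>f m \<in> Z\<close> y(1) Z_sub_center by (auto simp: center_def)
          moreover have "f (m \<otimes> h) = f m \<otimes> y \<otimes> k"
            using that h y \<open>f m \<in> Z\<close> by (simp add: M_def m_assoc)
          ultimately show ?thesis using y \<open>f m \<in> Z\<close> by (simp add: m_assoc)
        qed
        ultimately show ?thesis
          using y subgroup_Z by (simp add: proj_mult subgroup.m_closed)
      qed
      ultimately show ?thesis by (auto simp: r_coset_def)
    qed
    then show ?thesis using rcoset_in_Q[OF h] y by (simp add: g_def proj_mult)
  qed
  have ih: "inv h \<in> H" using h subgroup_H by (simp add: subgroup.m_inv_closed)
  have "inv\<^bsub>Q\<^esub> (M #> h) = M #> inv h"
  proof (rule Q.inv_equality)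
    show "(M #> inv h) \<otimes>\<^bsub>Q\<^esub> (M #> h) = \<one>\<^bsub>Q\<^esub>"
      using h mult_Q[OF ih h] coset_mult_one[OF subgroup.subset[OF subgroup_M]] by simp
  qed (rule rcoset_in_Q, fact)+
  \<comment> \<open>This coset is the displacement of M h under g, so it is central in
    \<open>Q\<close>.\<close>
  then have "M #> (inv h \<otimes> y) \<in> center Q"
    using Q.auto_central_if_comm[OF comm g rcoset_in_Q[OF h]] \<open>g (M #> h) = M #> y\<close> mult_Q[OF ih y(1)] by simp
  then have "inv h \<otimes> y \<in> D"
    unfolding cQ using ih y subgroup_H by (intro derived_Q) (simp_all add: subgroup.m_closed)
  moreover have "f h = h \<otimes> (inv h \<otimes> y) \<otimes> k" using y h by (simp add: mult_inv_cancel)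
  ultimately show thesis using that y(2) by blast
qed

text \<open>Both claims are proved together because the second rests on the first: f is central, so
  it fixes D, and comparing p-th powers of elements and their images inside D then pushes each
  displacement from D Z into D.\<close>

lemma auto_mod_D:
  assumes comm: "comm_group (AutoGroup Q)" and cQ: "center Q = derived Q (carrier Q)"
  shows auto_fixes_D: "d \<in> D \<Longrightarrow> f d = d"
    and auto_shift_D: "x \<in> carrier G \<Longrightarrow> \<exists>d\<in>D. f x = x \<otimes> d"
proof -
  have cent: "\<exists>c\<in>center G. f x = x \<otimes> c" if "x \<in> carrier G" for x
  proof -
    obtain h l where x: "h \<in> H" "l \<in> Z" "x = h \<otimes> l" using \<open>x \<in> carrier G\<close> by (rule decomposeE)
    obtain d k where dk: "d \<in> D" "k \<in> Z" "f h = h \<otimes> d \<otimes> k" using auto_mod_Z[OF comm cQ x(1)] .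
    have cl: "l \<in> center G" "f l \<in> center G"
      using x Z_sub_center auto_center[of l] by auto
    \<comment> \<open>From f (h l) = h d k (f l), moving l back to the left leaves this factor as
      the displacement of x = h l.\<close>
    have mem: "d \<otimes> k \<otimes> f l \<otimes> inv l \<in> center G"
      by (intro subgroup.m_closed[OF subgroup_center] subgroup.m_inv_closed[OF subgroup_center]
          cl subsetD[OF D_sub_center dk(1)] subsetD[OF Z_sub_center dk(2)])
    have "l \<otimes> (d \<otimes> k \<otimes> f l \<otimes> inv l) = (d \<otimes> k \<otimes> f l \<otimes> inv l) \<otimes> l"
      using cl(1) mem unfolding center_def by blast
    then have "h \<otimes> (l \<otimes> (d \<otimes> k \<otimes> f l \<otimes> inv l)) = h \<otimes> (d \<otimes> k \<otimes> f l \<otimes> inv l \<otimes> l)"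
      by simp
    then have "f x = x \<otimes> (d \<otimes> k \<otimes> f l \<otimes> inv l)"
      using x dk by (simp add: m_assoc)
    with mem show ?thesis by blast
  qed
  show fixD: "f d = d" if "d \<in> D" for d
    using central_hom_fixes_derived[OF f.homh cent] that derived_carrier by simp
  have Hshift: "\<exists>d\<in>D. f h = h \<otimes> d" if h: "h \<in> H" for h
  proof -
    obtain d k where dk: "d \<in> D" "k \<in> Z" "f h = h \<otimes> d \<otimes> k" using auto_mod_Z[OF comm cQ h] .
    \<comment> \<open>The power h^p is in D and so is fixed by f; hence k^p = 1 and k lies in
      M.\<close>
    have "h [^] p = f (h [^] p)" using fixD H_pow[OF h] by simp
    also have "\<dots> = h [^] p \<otimes> k [^] p" using h dk by (simp add: f.hom_nat_pow pow_central_mult)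
    finally have "k [^] p = \<one>" using h dk by (simp add: l_cancel_one')
    then have "k \<in> D" using dk Z_torsion M_sub by auto
    then have "d \<otimes> k \<in> D" using dk subgroup_D by (simp add: subgroup.m_closed)
    then show ?thesis using dk h by (auto simp: m_assoc)
  qed
  have zshift: "\<exists>d\<in>D. f k = k \<otimes> d" if k: "k \<in> Z" for k
  proof -
    have "f k \<in> center G" using k Z_sub_center auto_center[of k] by auto
    then obtain d l where dl: "d \<in> D" "l \<in> Z" "f k = d \<otimes> l" by (rule centerE)
    \<comment> \<open>Now k^p lies in M, so f fixes it and l^p = k^p. The quotient of l by k is
      therefore p-torsion in Z and belongs to M.\<close>
    have "k [^] p \<in> D" using k M_sub unfolding pow_eq_M by auto
    then have "k [^] p = f (k [^] p)" using fixD by simp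
    also have "\<dots> = (\<one> \<otimes> d \<otimes> l) [^] p" using k dl by (simp add: f.hom_nat_pow)
    also have "\<dots> = l [^] p" using dl pow_central_mult[of \<one> d l] by simp
    finally have eq: "k [^] p = l [^] p" .
    have ck: "inv k \<otimes> l = l \<otimes> inv k" "d \<otimes> k = k \<otimes> d"
      using dl k Z_sub_center subgroup.m_inv_closed[OF subgroup_Z k] by (auto simp: center_def)
    have "(inv k \<otimes> l) [^] p = \<one>"
      using k dl eq by (simp add: pow_mult_distrib[OF ck(1)] nat_pow_inv)
    moreover have "inv k \<otimes> l \<in> Z"
      using k dl subgroup_Z by (simp add: subgroup.m_closed subgroup.m_inv_closed)
    ultimately have "inv k \<otimes> l \<in> D" using Z_torsion M_sub by auto
    then have "d \<otimes> (inv k \<otimes> l) \<in> D" using dl subgroup_D by (simp add: subgroup.m_closed)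
    moreover have "f k = k \<otimes> (d \<otimes> (inv k \<otimes> l))"
    proof -
      have "k \<otimes> (d \<otimes> (inv k \<otimes> l)) = (k \<otimes> d) \<otimes> (inv k \<otimes> l)"
        using k dl by (simp add: m_assoc)
      also have "\<dots> = d \<otimes> (k \<otimes> (inv k \<otimes> l))"
        unfolding ck(2)[symmetric] using k dl by (simp add: m_assoc)
      finally show ?thesis using k dl by (simp add: mult_inv_cancel)
    qed
    ultimately show ?thesis by blast
  qed
  show "\<exists>d\<in>D. f x = x \<otimes> d" if "x \<in> carrier G" for x
  proof -
    obtain h l where x: "h \<in> H" "l \<in> Z" "x = h \<otimes> l" using \<open>x \<in> carrier G\<close> by (rule decomposeE)
    obtain d e where d: "d \<in> D" "f h = h \<otimes> d" and e: "e \<in> D" "f l = l \<otimes> e"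
      using Hshift zshift x by meson
    have "l \<otimes> d = d \<otimes> l" using x(2) d Z_sub_center by (auto simp: center_def)
    then have "f x = x \<otimes> (d \<otimes> e)"
      using x d e by (simp add: m_assoc) (simp flip: m_assoc)
    moreover have "d \<otimes> e \<in> D" using d e subgroup_D by (simp add: subgroup.m_closed)
    ultimately show ?thesis by blast
  qed
qed

end

lemma comm_AutoGroup:
  assumes "comm_group (AutoGroup Q)" "center Q = derived Q (carrier Q)"
  shows "comm_group (AutoGroup G)"
proof (rule comm_AutoGroupI[of D])
  show "d \<otimes> x = x \<otimes> d" if "d \<in> D" "x \<in> D" for d x
    using that D_sub_center by (auto simp: center_def)
  show "D \<subseteq> carrier G" by auto
  show "\<exists>d\<in>D. f x = x \<otimes> d" if "f \<in> auto G" "x \<in> carrier G" for f x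
    using auto_shift_D[OF that(1) assms that(2)] .
  show "f d = d" if "f \<in> auto G" "d \<in> D" for f d
    using auto_fixes_D[OF that(1) assms that(2)] .
qed

end

section \<open>The Miller property of the amalgamated product\<close>

theorem theoremC:
  fixes G\<^sub>1 :: "('a, 'b) monoid_scheme"
    and H M :: "'a set"
    and z :: 'a
    and p :: nat
  assumes "Factorial_Ring.prime p" and "odd p"
    and "group G\<^sub>1"
    and "subgroup H G\<^sub>1"
    and "finite H"
    and "p_group p (G\<^sub>1\<lparr>carrier := H\<rparr>)"
    and "special (G\<^sub>1\<lparr>carrier := H\<rparr>)"
    and "miller_group (G\<^sub>1\<lparr>carrier := H\<rparr>)"
    and "power_subgroup p (G\<^sub>1\<lparr>carrier := H\<rparr>) \<subset> commutator_subgroup (G\<^sub>1\<lparr>carrier := H\<rparr>)"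
    and "inj_on (coset_power_map p (G\<^sub>1\<lparr>carrier := H\<rparr>))
           (carrier (G\<^sub>1\<lparr>carrier := H\<rparr> Mod commutator_subgroup (G\<^sub>1\<lparr>carrier := H\<rparr>)))"
    and "subgroup M (G\<^sub>1\<lparr>carrier := H\<rparr>)"
    and "card M = p"
    and "M \<subseteq> commutator_subgroup (G\<^sub>1\<lparr>carrier := H\<rparr>)"
    and "\<not> M \<subseteq> power_subgroup p (G\<^sub>1\<lparr>carrier := H\<rparr>)"
    and "z \<in> carrier G\<^sub>1"
    and "group.ord G\<^sub>1 z = p ^ 2"
    and "\<forall>h \<in> H. z \<otimes>\<^bsub>G\<^sub>1\<^esub> h = h \<otimes>\<^bsub>G\<^sub>1\<^esub> z"
    and "M = generate G\<^sub>1 {z [^]\<^bsub>G\<^sub>1\<^esub> p}"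
    and "amalgamated_semidirect_product G\<^sub>1 H (generate G\<^sub>1 {z}) M"
    and "p_group p (G\<^sub>1\<lparr>carrier := H\<rparr> Mod M)"
    and "special (G\<^sub>1\<lparr>carrier := H\<rparr> Mod M)"
    and "miller_group (G\<^sub>1\<lparr>carrier := H\<rparr> Mod M)"
  shows "miller_group G\<^sub>1 \<and> \<not> special G\<^sub>1"
proof -
  interpret G: group G\<^sub>1 by fact
  let ?H = "G\<^sub>1\<lparr>carrier := H\<rparr>"
  interpret HG: group ?H using assms(4) by (rule G.subgroup_imp_group)
  have der: "derived ?H H = derived G\<^sub>1 H"
    by (intro G.derived_consistent assms(4)) simp
  have cen: "center ?H = derived G\<^sub>1 H" and fra: "frattini ?H = derived G\<^sub>1 H"
    using assms(7) der by (simp_all add: special_def commutator_subgroup_def)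
  \<comment> \<open>In the special group H the Frattini subgroup is also the derived subgroup and
    the center, so this provides the central p-th powers from which the exponent of D
    follows.\<close>
  have pow: "h [^]\<^bsub>?H\<^esub> p \<in> derived G\<^sub>1 H" if "h \<in> H" for h
    using HG.pow_prime_mem_frattini[of p h] assms(1,6) that der fra by simp
  have expo: "d [^]\<^bsub>?H\<^esub> p = \<one>\<^bsub>?H\<^esub>" if "d \<in> derived G\<^sub>1 H" for d
    using HG.derived_exponent[of p d] pow that der cen by simp
  have amal: "carrier G\<^sub>1 = H <#>\<^bsub>G\<^sub>1\<^esub> generate G\<^sub>1 {z}" "H \<inter> generate G\<^sub>1 {z} = M"
    using assms(19) by (simp_all add: amalgamated_semidirect_product_def)
  \<comment> \<open>The facts obtained inside H as a group of its own are carried over to the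
    operations of the ambient group.\<close>
  interpret A: cyclic_central_amalgam G\<^sub>1 H "generate G\<^sub>1 {z}" "derived G\<^sub>1 H" "H \<inter> generate G\<^sub>1 {z}" z p
  proof (intro cyclic_central_amalgam.intro cyclic_central_amalgam_axioms.intro)
    show "z \<otimes>\<^bsub>G\<^sub>1\<^esub> h = h \<otimes>\<^bsub>G\<^sub>1\<^esub> z" if "h \<in> H" for h
      using assms(17) that by blast
    show "H \<inter> generate G\<^sub>1 {z} \<subseteq> derived G\<^sub>1 H"
      using assms(13) der amal by (simp add: commutator_subgroup_def)
    show "d [^]\<^bsub>G\<^sub>1\<^esub> p = \<one>\<^bsub>G\<^sub>1\<^esub>" if "d \<in> derived G\<^sub>1 H" for d
      using expo[OF that] unfolding G.nat_pow_consistent[of d p H] by simp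
    show "h [^]\<^bsub>G\<^sub>1\<^esub> p \<in> derived G\<^sub>1 H" if "h \<in> H" for h
      using pow[OF that] unfolding G.nat_pow_consistent[of h p H] .
    show "H \<inter> generate G\<^sub>1 {z} = generate G\<^sub>1 {z [^]\<^bsub>G\<^sub>1\<^esub> p}"
      using amal(2) assms(18) by (rule trans)
  qed (fact assms amal cen)+
  have "comm_group (AutoGroup G\<^sub>1)"
  proof (rule A.comm_AutoGroup)
    show "comm_group (AutoGroup (?H Mod (H \<inter> generate G\<^sub>1 {z})))"
      using assms(22) unfolding amal(2) miller_group_def by blast
    show "center (?H Mod (H \<inter> generate G\<^sub>1 {z})) = derived (?H Mod (H \<inter> generate G\<^sub>1 {z})) (carrier (?H Mod (H \<inter> generate G\<^sub>1 {z})))"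
      using assms(21) unfolding amal(2) special_def commutator_subgroup_def by blast
  qed
  \<comment> \<open>A commutative ambient group would make the non-abelian subgroup H
    commutative.\<close>
  moreover have "\<not> comm_group G\<^sub>1"
  proof
    assume "comm_group G\<^sub>1"
    then interpret C: comm_group G\<^sub>1 .
    have "comm_group ?H"
      by (rule HG.group_comm_groupI) (simp add: A.mem_carrier(1) C.m_comm)
    then show False using assms(8) unfolding miller_group_def by blast
  qed
  ultimately show ?thesis
    using A.not_special assms(3) unfolding miller_group_def by blast
qed

end
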